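(* Let $n\ge 1$ and let $\boldsymbol{\alpha}=(\alpha_1,\dots,\alpha_n)$ be an $n$-tuple of pairwise independent irrational real numbers. If $\mathfrak{k}(\boldsymbol{\alpha})=k$, then $$ n \le \frac{k(k+1)}{2}. $$
   Context: For an irrational $\xi\in\mathbb{R}$ define the irrationality measure function $\psi_\xi(t)=\min_{1\le q\le t,\ q\in\mathbb{Z}}\|q\xi\|$ for real $t\ge 1$, where $\|x\|$ denotes the distance from $x$ to the nearest integer. Two irrational numbers $\alpha,\beta$ are called independent if $\psi_\alpha(t)\ne\psi_\beta(t)$ for all sufficiently large $t$. For an $n$-tuple $\boldsymbol{\alpha}=(\alpha_1,\dots,\alpha_n)$ of pairwise independent irrational numbers, for all sufficiently large $t$ there is a well-defined permutation $\boldsymbol{\sigma}(t)=(\sigma_1,\dots,\sigma_n)$ of $\{1,\dots,n\}$ determined by $\psi_{\alpha_{\sigma_1}}(t)>\psi_{\alpha_{\sigma_2}}(t)>\dots>\psi_{\alpha_{\sigma_n}}(t)$. The $\mathfrak{k}$-index $\mathfrak{k}(\boldsymbol{\alpha})$ is the number of distinct permutations $\boldsymbol{\sigma}_j$ which occur infinitely often, i.e. such that for every $t_0>0$ there is $t>t_0$ with $\boldsymbol{\sigma}(t)=\boldsymbol{\sigma}_j$. *)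

theory Defs
  imports Complex_Main "HOL-Combinatorics.Permutations"
begin

definition dist_nearest_int :: "real \<Rightarrow> real" where
  "dist_nearest_int x = \<bar>x - of_int (round x)\<bar>"

(* Only meaningful for t \<ge> 1: otherwise the set is empty and Min is unspecified. *)
definition irrationality_measure_fun :: "real \<Rightarrow> real \<Rightarrow> real" where
  "irrationality_measure_fun \<xi> t =
     Min ((\<lambda>q. dist_nearest_int (of_int q * \<xi>)) ` {q :: int. 1 \<le> q \<and> of_int q \<le> t})"

definition independent_irrationals :: "real \<Rightarrow> real \<Rightarrow> bool" where
  "independent_irrationals \<alpha> \<beta> \<longleftrightarrow>
     \<alpha> \<notin> \<rat> \<and> \<beta> \<notin> \<rat> \<and>
     (\<forall>\<^sub>F t in at_top. irrationality_measure_fun \<alpha> t \<noteq> irrationality_measure_fun \<beta> t)"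

(* An n-tuple is a function on the naturals of which only the values on {1..n} matter. *)
definition is_ordering_perm :: "nat \<Rightarrow> (nat \<Rightarrow> real) \<Rightarrow> real \<Rightarrow> (nat \<Rightarrow> nat) \<Rightarrow> bool" where
  "is_ordering_perm n \<alpha> t \<sigma> \<longleftrightarrow>
     \<sigma> permutes {1..n} \<and>
     (\<forall>i\<in>{1..n}. \<forall>j\<in>{1..n}. i < j \<longrightarrow>
        irrationality_measure_fun (\<alpha> (\<sigma> i)) t > irrationality_measure_fun (\<alpha> (\<sigma> j)) t)"

(* Unspecified at those t where two of the functions agree; for pairwise independent tuples such
   t are bounded above (eventually_ex1_ordering_perm below), so k_index does not see them. *)
definition ordering_perm :: "nat \<Rightarrow> (nat \<Rightarrow> real) \<Rightarrow> real \<Rightarrow> (nat \<Rightarrow> nat)" where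
  "ordering_perm n \<alpha> t = (THE \<sigma>. is_ordering_perm n \<alpha> t \<sigma>)"

definition k_index :: "nat \<Rightarrow> (nat \<Rightarrow> real) \<Rightarrow> nat" where
  "k_index n \<alpha> = card {\<sigma>. \<forall>t\<^sub>0>0. \<exists>t>t\<^sub>0. ordering_perm n \<alpha> t = \<sigma>}"

lemma ex1_decreasing_perm:
  fixes f :: "nat \<Rightarrow> real"
  assumes inj: "inj_on f {1..n}"
  shows "\<exists>!\<sigma>. \<sigma> permutes {1..n} \<and> (\<forall>i\<in>{1..n}. \<forall>j\<in>{1..n}. i < j \<longrightarrow> f (\<sigma> i) > f (\<sigma> j))"
proof (rule ex_ex1I)
  define g where "g i = - f i" for i
  have injg: "inj_on g {1..n}"
    using inj unfolding g_def inj_on_def neg_equal_iff_equal .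
  define xs where "xs = sorted_list_of_set (g ` {1..n})"
  have len: "length xs = n"
    using card_image[OF injg] by (simp add: xs_def)
  have set_xs: "set xs = g ` {1..n}"
    by (simp add: xs_def)
  have mono: "xs ! i < xs ! j" if "i < j" "j < n" for i j
  proof -
    have "sorted_wrt (<) xs"
      unfolding xs_def by (rule strict_sorted_list_of_set)
    then show ?thesis
      using that len by (simp add: sorted_wrt_iff_nth_less)
  qed
  have nth_in: "xs ! (i - 1) \<in> g ` {1..n}" if "i \<in> {1..n}" for i
  proof -
    have "i - 1 < length xs"
      using that len unfolding atLeastAtMost_iff by linarith
    then show ?thesis
      using set_xs nth_mem by blast
  qed
  define \<sigma> where "\<sigma> i = (if i \<in> {1..n} then inv_into {1..n} g (xs ! (i - 1)) else i)" for i
  have \<sigma>_in: "\<sigma> i \<in> {1..n}" if "i \<in> {1..n}" for i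
    using inv_into_into[OF nth_in[OF that]] that by (simp add: \<sigma>_def)
  have g\<sigma>: "g (\<sigma> i) = xs ! (i - 1)" if "i \<in> {1..n}" for i
    using f_inv_into_f[OF nth_in[OF that]] that by (simp add: \<sigma>_def)
  have dec: "g (\<sigma> i) < g (\<sigma> j)" if "i \<in> {1..n}" "j \<in> {1..n}" "i < j" for i j
  proof -
    have "i - 1 < j - 1" "j - 1 < n"
      using that unfolding atLeastAtMost_iff by linarith+
    then show ?thesis
      using mono g\<sigma> that by metis
  qed
  have "inj_on \<sigma> {1..n}"
  proof (rule inj_onI)
    fix i j
    assume "i \<in> {1..n}" "j \<in> {1..n}" "\<sigma> i = \<sigma> j"
    then show "i = j"
      using dec[of i j] dec[of j i] by (cases i j rule: linorder_cases) auto
  qed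
  moreover have "\<sigma> ` {1..n} \<subseteq> {1..n}"
    using \<sigma>_in by blast
  ultimately have "bij_betw \<sigma> {1..n} {1..n}"
    by (simp add: bij_betw_def endo_inj_surj)
  then have "\<sigma> permutes {1..n}"
    by (rule bij_imp_permutes) (simp only: \<sigma>_def if_False)
  then show "\<exists>\<sigma>. \<sigma> permutes {1..n} \<and> (\<forall>i\<in>{1..n}. \<forall>j\<in>{1..n}. i < j \<longrightarrow> f (\<sigma> i) > f (\<sigma> j))"
    using dec unfolding g_def neg_less_iff_less by blast
next
  fix \<sigma> \<tau>
  assume A: "\<sigma> permutes {1..n} \<and> (\<forall>i\<in>{1..n}. \<forall>j\<in>{1..n}. i < j \<longrightarrow> f (\<sigma> i) > f (\<sigma> j))"
  assume B: "\<tau> permutes {1..n} \<and> (\<forall>i\<in>{1..n}. \<forall>j\<in>{1..n}. i < j \<longrightarrow> f (\<tau> i) > f (\<tau> j))"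
  define L where "L \<rho> = map (\<lambda>i. - f (\<rho> i)) [1..<Suc n]" for \<rho> :: "nat \<Rightarrow> nat"
  have *: "sorted_wrt (<) (L \<rho>) \<and> set (L \<rho>) = (\<lambda>i. - f i) ` {1..n}"
    if "\<rho> permutes {1..n} \<and> (\<forall>i\<in>{1..n}. \<forall>j\<in>{1..n}. i < j \<longrightarrow> f (\<rho> i) > f (\<rho> j))" for \<rho>
  proof
    show "sorted_wrt (<) (L \<rho>)"
      using that unfolding L_def sorted_wrt_map
      by (intro sorted_wrt_mono_rel[OF _ sorted_wrt_upt]) (simp del: upt_Suc)
    have "set (L \<rho>) = (\<lambda>i. - f i) ` (\<rho> ` {1..n})"
      by (simp only: L_def set_map set_upt image_image atLeastLessThanSuc_atLeastAtMost)
    then show "set (L \<rho>) = (\<lambda>i. - f i) ` {1..n}"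
      using that by (simp only: permutes_image)
  qed
  have L_eq: "L \<sigma> = L \<tau>"
    using *[OF A] *[OF B] by (metis strict_sorted_equal)
  have eq: "f (\<sigma> i) = f (\<tau> i)" if "i \<in> {1..n}" for i
  proof -
    have "i \<in> set [1..<Suc n]"
      using that by (simp only: set_upt atLeastLessThanSuc_atLeastAtMost)
    moreover have "map (\<lambda>i. - f (\<sigma> i)) [1..<Suc n] = map (\<lambda>i. - f (\<tau> i)) [1..<Suc n]"
      using L_eq by (simp only: L_def)
    ultimately have "- f (\<sigma> i) = - f (\<tau> i)"
      unfolding map_eq_conv by blast
    then show ?thesis
      by simp
  qed
  show "\<sigma> = \<tau>"
  proof
    fix i
    show "\<sigma> i = \<tau> i"
    proof (cases "i \<in> {1..n}")
      case True
      then show ?thesis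
        using eq[OF True] inj A B by (meson inj_onD permutes_in_image)
    next
      case False
      then show ?thesis
        using A B by (metis permutes_not_in)
    qed
  qed
qed

lemma eventually_ex1_ordering_perm:
  assumes "pairwise (\<lambda>i j. independent_irrationals (\<alpha> i) (\<alpha> j)) {1..n}"
  shows "\<forall>\<^sub>F t in at_top. \<exists>!\<sigma>. is_ordering_perm n \<alpha> t \<sigma>"
proof -
  have "\<forall>\<^sub>F t in at_top. \<forall>i\<in>{1..n}. \<forall>j\<in>{1..n}. i \<noteq> j \<longrightarrow>
      irrationality_measure_fun (\<alpha> i) t \<noteq> irrationality_measure_fun (\<alpha> j) t"
  proof (intro eventually_ball_finite finite_atLeastAtMost ballI)
    fix i j
    assume "i \<in> {1..n}" "j \<in> {1..n}"
    then show "\<forall>\<^sub>F t in at_top. i \<noteq> j \<longrightarrow>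
        irrationality_measure_fun (\<alpha> i) t \<noteq> irrationality_measure_fun (\<alpha> j) t"
      using pairwiseD[OF assms, of i j] by (cases "i = j") (simp_all add: independent_irrationals_def)
  qed
  then show ?thesis
  proof eventually_elim
    case (elim t)
    then have "inj_on (\<lambda>i. irrationality_measure_fun (\<alpha> i) t) {1..n}"
      by (auto simp: inj_on_def)
    then show ?case
      unfolding is_ordering_perm_def by (rule ex1_decreasing_perm)
  qed
qed

end

(* The function psi_alpha is a decreasing step function that jumps at the denominators of the best
   approximations to alpha.  Consecutive denominators q < r with errors d_q > d_r satisfy
   r d_q + q d_r = 1, and this forces two staircases to interleave: neither can stay below the other
   for ever, and if both jump at a large time t, then the one that is lower just before t crossed
   the other one from above exactly at its own previous jump.  Moreover two independent numbers have
   no pair of consecutive denominators (s, t) in common once t is large, since such a pair determines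
   all earlier denominators.  Hence m simultaneous jumps produce m different orderings, so at most k
   of the functions jump at any large time.  Deleting the functions that jump at a time where the
   ordering changes therefore removes at most k functions and at least one ordering, and induction
   gives n <= k + (k - 1) + ... + 1. *)

theory Submission
  imports Defs
begin

section \<open>Approximation errors and Dirichlet's theorem\<close>

definition signed_error :: "real \<Rightarrow> nat \<Rightarrow> real" where
  "signed_error \<alpha> m = real m * \<alpha> - of_int (round (real m * \<alpha>))"

definition error :: "real \<Rightarrow> nat \<Rightarrow> real" where
  "error \<alpha> m = \<bar>signed_error \<alpha> m\<bar>"

definition best :: "real \<Rightarrow> nat \<Rightarrow> bool" where
  "best \<alpha> q \<longleftrightarrow> 1 \<le> q \<and> (\<forall>m. 1 \<le> m \<and> m < q \<longrightarrow> error \<alpha> q < error \<alpha> m)"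

definition consec :: "real \<Rightarrow> nat \<Rightarrow> nat \<Rightarrow> bool" where
  "consec \<alpha> q r \<longleftrightarrow> best \<alpha> q \<and> best \<alpha> r \<and> q < r \<and> (\<forall>m. q < m \<and> m < r \<longrightarrow> \<not> best \<alpha> m)"

text \<open>The irrationality measure function at integer times
  (\<open>irrationality_measure_fun_eq_psi\<close>). From time 1 on it changes value only there, so
  sampling loses nothing.\<close>

definition psi :: "real \<Rightarrow> nat \<Rightarrow> real" where
  "psi \<alpha> n = Min (error \<alpha> ` {1..n})"

lemma error_minimal: "error \<alpha> m \<le> \<bar>real m * \<alpha> - of_int p\<bar>"
  unfolding error_def signed_error_def by (rule round_diff_minimal)

lemma error_pos:
  assumes "\<alpha> \<notin> \<rat>" "1 \<le> m"
  shows "0 < error \<alpha> m"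
proof (rule ccontr)
  assume "\<not> 0 < error \<alpha> m"
  then have "real m * \<alpha> = of_int (round (real m * \<alpha>))"
    by (simp add: error_def signed_error_def)
  then have "\<alpha> = of_int (round (real m * \<alpha>)) / real m"
    using assms(2) by (simp add: field_simps)
  then have "\<alpha> \<in> \<rat>"
    by (metis Rats_divide Rats_of_int Rats_of_nat)
  then show False using assms(1) by simp
qed

lemma error_diff_le:
  assumes "m \<le> n"
  shows "error \<alpha> (n - m) \<le> \<bar>signed_error \<alpha> n - signed_error \<alpha> m\<bar>"
  using error_minimal[of \<alpha> "n - m" "round (real n * \<alpha>) - round (real m * \<alpha>)"] assms
  by (simp add: signed_error_def of_nat_diff algebra_simps)

text \<open>Pigeonhole: the \<open>N\<close> fractional parts of \<open>m * \<alpha>\<close> with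
  \<open>m < N\<close> meet \<open>N\<close> boxes of length \<open>1 / N\<close>. Either two share
  a box, and the difference of their indices is the witness, or every box is occupied, and the point
  in the last box is close to the next integer. Thus \<open>m\<close> stays strictly below
  \<open>N\<close>, as \<open>consec_identity\<close> requires.\<close>

lemma dirichlet_error:
  assumes "2 \<le> N"
  shows "\<exists>m. 1 \<le> m \<and> m < N \<and> error \<alpha> m \<le> 1 / real N"
proof -
  define g where "g m = nat \<lfloor>real N * frac (real m * \<alpha>)\<rfloor>" for m :: nat
  have fl: "real (g m) \<le> real N * frac (real m * \<alpha>) \<and> real N * frac (real m * \<alpha>) < real (g m) + 1" for m
  proof -
    have "0 \<le> real N * frac (real m * \<alpha>)" by simp
    then have "real (g m) = of_int \<lfloor>real N * frac (real m * \<alpha>)\<rfloor>"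
      by (simp add: g_def)
    then show ?thesis by linarith
  qed
  have g_lt: "g m < N" for m
  proof -
    have "real N * frac (real m * \<alpha>) < real N * 1"
      using assms by (intro mult_strict_left_mono frac_lt_1) auto
    then show ?thesis using fl[of m] by simp
  qed
  show ?thesis
  proof (cases "inj_on g {0..<N}")
    case True
    then have "g ` {0..<N} = {0..<N}"
      by (intro endo_inj_surj) (use g_lt in auto)
    moreover have "N - 1 \<in> {0..<N}" using assms by simp
    ultimately obtain m where m: "m < N" "g m = N - 1"
      by (metis (no_types, lifting) atLeastLessThan_iff imageE)
    \<comment> \<open>The index 0 falls into box 0, which is not the last box since
      \<open>2 \<le> N\<close>.\<close>
    have "m \<noteq> 0" using m assms by (intro notI) (simp add: g_def)
    have "real N * frac (real m * \<alpha>) \<ge> real N - 1"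
      using fl[of m] m assms by (simp add: of_nat_diff)
    then have "1 - frac (real m * \<alpha>) \<le> 1 / real N"
      using assms by (simp add: field_simps)
    moreover have "error \<alpha> m \<le> \<bar>real m * \<alpha> - of_int (\<lfloor>real m * \<alpha>\<rfloor> + 1)\<bar>"
      by (rule error_minimal)
    moreover have "\<bar>real m * \<alpha> - of_int (\<lfloor>real m * \<alpha>\<rfloor> + 1)\<bar> = 1 - frac (real m * \<alpha>)"
      using frac_lt_1[of "real m * \<alpha>"] by (simp add: frac_def abs_if)
    ultimately have "error \<alpha> m \<le> 1 / real N" by linarith
    then show ?thesis using m \<open>m \<noteq> 0\<close> by (intro exI[of _ m]) simp
  next
    case False
    then obtain a b where ab: "a < b" "b < N" "g a = g b"
      unfolding inj_on_def by (metis atLeastLessThan_iff nat_neq_iff)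
    have "real N * \<bar>frac (real b * \<alpha>) - frac (real a * \<alpha>)\<bar>
        = \<bar>real N * frac (real b * \<alpha>) - real N * frac (real a * \<alpha>)\<bar>"
      by (simp add: abs_mult flip: right_diff_distrib)
    also have "\<dots> < 1" using fl[of a] fl[of b] ab(3) by linarith
    finally have "\<bar>frac (real b * \<alpha>) - frac (real a * \<alpha>)\<bar> < 1 / real N"
      using assms by (simp add: field_simps)
    moreover have "error \<alpha> (b - a) \<le> \<bar>real (b - a) * \<alpha> - of_int (\<lfloor>real b * \<alpha>\<rfloor> - \<lfloor>real a * \<alpha>\<rfloor>)\<bar>"
      by (rule error_minimal)
    moreover have "real (b - a) * \<alpha> - of_int (\<lfloor>real b * \<alpha>\<rfloor> - \<lfloor>real a * \<alpha>\<rfloor>)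
        = frac (real b * \<alpha>) - frac (real a * \<alpha>)"
      using ab by (simp add: frac_def of_nat_diff algebra_simps)
    ultimately have "error \<alpha> (b - a) \<le> 1 / real N" by linarith
    then show ?thesis using ab by (intro exI[of _ "b - a"]) auto
  qed
qed

section \<open>Best denominators and the staircase \<open>psi\<close>\<close>

lemma best_ge_1: "best \<alpha> q \<Longrightarrow> 1 \<le> q"
  by (simp add: best_def)

lemma best_1: "best \<alpha> 1"
  by (simp add: best_def)

lemma best_error_less: "best \<alpha> q \<Longrightarrow> best \<alpha> r \<Longrightarrow> q < r \<Longrightarrow> error \<alpha> r < error \<alpha> q"
  by (simp add: best_def)

lemma consecD:
  assumes "consec \<alpha> q r"
  shows "best \<alpha> q" "best \<alpha> r" "q < r" "1 \<le> q" "error \<alpha> r < error \<alpha> q"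
    "\<And>m. best \<alpha> m \<Longrightarrow> m < r \<Longrightarrow> m \<le> q" "\<And>m. best \<alpha> m \<Longrightarrow> q < m \<Longrightarrow> r \<le> m"
proof -
  show 1: "best \<alpha> q" "best \<alpha> r" "q < r"
    using assms by (simp_all add: consec_def)
  then show "1 \<le> q" "error \<alpha> r < error \<alpha> q"
    using best_ge_1 best_error_less by blast+
  show "m \<le> q" if "best \<alpha> m" "m < r" for m
    using assms that unfolding consec_def by (metis not_le)
  show "r \<le> m" if "best \<alpha> m" "q < m" for m
    using assms that unfolding consec_def by (metis not_le)
qed

text \<open>The least index at which the minimum is attained is a strict record of the
  errors.\<close>

lemma least_minimiser_best:
  assumes "1 \<le> n"
  shows "\<exists>m\<le>n. best \<alpha> m \<and> psi \<alpha> n = error \<alpha> m"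
proof -
  have "psi \<alpha> n \<in> error \<alpha> ` {1..n}"
    unfolding psi_def using assms by (intro Min_in) auto
  then have ex: "\<exists>m. 1 \<le> m \<and> m \<le> n \<and> error \<alpha> m = psi \<alpha> n" by auto
  define m where "m = (LEAST m. 1 \<le> m \<and> m \<le> n \<and> error \<alpha> m = psi \<alpha> n)"
  have m: "1 \<le> m" "m \<le> n" "error \<alpha> m = psi \<alpha> n"
    using LeastI_ex[OF ex] unfolding m_def by auto
  have "error \<alpha> m < error \<alpha> l" if "1 \<le> l" "l < m" for l
  proof -
    have "psi \<alpha> n \<le> error \<alpha> l"
      unfolding psi_def using that m by (intro Min_le) auto
    moreover have "error \<alpha> l \<noteq> psi \<alpha> n"
      using not_less_Least[of l "\<lambda>m. 1 \<le> m \<and> m \<le> n \<and> error \<alpha> m = psi \<alpha> n"] that m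
      unfolding m_def[symmetric] by auto
    ultimately show ?thesis using m by simp
  qed
  then show ?thesis using m by (intro exI[of _ m]) (auto simp: best_def)
qed

lemma psi_le: "1 \<le> m \<Longrightarrow> m \<le> n \<Longrightarrow> psi \<alpha> n \<le> error \<alpha> m"
  unfolding psi_def by (intro Min_le) auto

lemma psi_antimono: "1 \<le> m \<Longrightarrow> m \<le> n \<Longrightarrow> psi \<alpha> n \<le> psi \<alpha> m"
  unfolding psi_def by (intro Min_antimono image_mono) auto

lemma psi_eqI:
  assumes "best \<alpha> q" "q \<le> n" "\<And>m. best \<alpha> m \<Longrightarrow> m \<le> n \<Longrightarrow> m \<le> q"
  shows "psi \<alpha> n = error \<alpha> q"
proof -
  have "1 \<le> q" using assms(1) by (rule best_ge_1)
  then obtain m where m: "m \<le> n" "best \<alpha> m" "psi \<alpha> n = error \<alpha> m"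
    using least_minimiser_best[of n \<alpha>] assms(2) by force
  have "m \<le> q" using assms(3) m by blast
  then have "error \<alpha> q \<le> error \<alpha> m"
    using assms(1) m(2) best_error_less[of \<alpha> m q] by (cases "m = q") auto
  then show ?thesis using m(3) psi_le[of q n \<alpha>] \<open>1 \<le> q\<close> assms(2) by linarith
qed

lemma psi_best: "best \<alpha> q \<Longrightarrow> psi \<alpha> q = error \<alpha> q"
  by (rule psi_eqI) auto

lemma psi_consec: "consec \<alpha> q r \<Longrightarrow> q \<le> n \<Longrightarrow> n < r \<Longrightarrow> psi \<alpha> n = error \<alpha> q"
  by (rule psi_eqI) (auto intro: consecD(1,6) le_less_trans)

lemma psi_not_best:
  assumes "2 \<le> n" "\<not> best \<alpha> n"
  shows "psi \<alpha> (n - 1) = psi \<alpha> n"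
proof -
  obtain m where m: "m \<le> n" "best \<alpha> m" "psi \<alpha> n = error \<alpha> m"
    using least_minimiser_best[of n \<alpha>] assms(1) by auto
  then have "m \<le> n - 1" using assms(2) by (cases "m = n") auto
  then have "psi \<alpha> (n - 1) \<le> error \<alpha> m" using best_ge_1[OF m(2)] by (intro psi_le) auto
  moreover have "psi \<alpha> n \<le> psi \<alpha> (n - 1)" using assms(1) by (intro psi_antimono) auto
  ultimately show ?thesis using m by simp
qed

lemma ex_pred:
  assumes "1 < t"
  shows "\<exists>s. best \<alpha> s \<and> s < t \<and> (\<forall>m. best \<alpha> m \<longrightarrow> m < t \<longrightarrow> m \<le> s)"
proof -
  have fin: "finite {s. best \<alpha> s \<and> s < t}" by simp
  have ne: "{s. best \<alpha> s \<and> s < t} \<noteq> {}" using best_1 assms by blast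
  show ?thesis
    using Max_in[OF fin ne] Max_ge[OF fin] by (intro exI[of _ "Max {s. best \<alpha> s \<and> s < t}"]) auto
qed

lemma ex_consec_pred:
  assumes "best \<alpha> t" "1 < t"
  shows "\<exists>s. consec \<alpha> s t"
proof -
  obtain s where s: "best \<alpha> s" "s < t" "\<And>m. best \<alpha> m \<Longrightarrow> m < t \<Longrightarrow> m \<le> s"
    using ex_pred[OF assms(2), of \<alpha>] by blast
  then show ?thesis
    using assms(1) unfolding consec_def by (intro exI[of _ s]) force
qed

text \<open>The errors up to \<open>Suc n\<close> have a positive minimum \<open>c\<close>, and
  Dirichlet's theorem produces an error below \<open>c\<close>, so a best denominator with such an
  error lies beyond \<open>n\<close>. Taking \<open>Suc n\<close> instead of \<open>n\<close> keeps
  the minimum nonempty for \<open>n = 0\<close>.\<close>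

lemma ex_best_greater:
  assumes "\<alpha> \<notin> \<rat>"
  shows "\<exists>r>n. best \<alpha> r"
proof -
  define c where "c = psi \<alpha> (Suc n)"
  obtain m0 where "best \<alpha> m0" "c = error \<alpha> m0"
    using least_minimiser_best[of "Suc n" \<alpha>] unfolding c_def by auto
  then have c: "0 < c" using error_pos[OF assms] best_ge_1 by simp
  obtain N :: nat where N: "1 / c < real N" using reals_Archimedean2 by blast
  define M where "M = N + 2"
  have "1 / c < real M" using N by (simp add: M_def)
  then have "1 / real M < c" using c by (simp add: field_simps M_def)
  moreover obtain m where m: "1 \<le> m" "m < M" "error \<alpha> m \<le> 1 / real M"
    using dirichlet_error[of M \<alpha>] by (auto simp: M_def)
  ultimately have lt: "error \<alpha> m < c" by linarith
  obtain r where r: "r \<le> m" "best \<alpha> r" "psi \<alpha> m = error \<alpha> r"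
    using least_minimiser_best[of m \<alpha>] m by auto
  have "error \<alpha> r < c" using r(3) psi_le[of m m \<alpha>] m lt by simp
  then have "\<not> r \<le> n" using psi_le[of r "Suc n" \<alpha>] best_ge_1[OF r(2)] by (auto simp: c_def)
  then show ?thesis using r(2) by (intro exI[of _ r]) auto
qed

lemma ex_consec_above:
  assumes "\<alpha> \<notin> \<rat>" "1 \<le> n"
  shows "\<exists>q r. consec \<alpha> q r \<and> q \<le> n \<and> n < r"
proof -
  obtain q where q: "best \<alpha> q" "q < n + 1" "\<And>m. best \<alpha> m \<Longrightarrow> m < n + 1 \<Longrightarrow> m \<le> q"
    using ex_pred[of "n + 1" \<alpha>] assms(2) by auto
  define r where "r = (LEAST r. n < r \<and> best \<alpha> r)"
  have r: "n < r" "best \<alpha> r"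
    using LeastI_ex[of "\<lambda>r. n < r \<and> best \<alpha> r"] ex_best_greater[OF assms(1), of n]
    unfolding r_def by auto
  have "\<not> best \<alpha> m" if "q < m" "m < r" for m
    using q(3)[of m] not_less_Least[of m "\<lambda>r. n < r \<and> best \<alpha> r"] that unfolding r_def by force
  then show ?thesis using q r by (intro exI[of _ q] exI[of _ r]) (auto simp: consec_def)
qed

lemma ex_consec_succ:
  assumes "\<alpha> \<notin> \<rat>" "best \<alpha> q"
  shows "\<exists>r. consec \<alpha> q r"
proof -
  obtain p r where pr: "consec \<alpha> p r" "p \<le> q" "q < r"
    using ex_consec_above[OF assms(1), of q] best_ge_1[OF assms(2)] by auto
  then show ?thesis using consecD(6)[OF pr(1) assms(2)] by (metis le_antisym)
qed

section \<open>Determinants and the continued fraction recurrence\<close>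

text \<open>A determinant of two points \<open>(m, m * \<alpha> - p)\<close> with integer
  \<open>p\<close>: the terms with \<alpha> cancel.\<close>

lemma det_Ints: "real m * signed_error \<alpha> n - real n * signed_error \<alpha> m \<in> \<int>"
proof -
  have "real m * signed_error \<alpha> n - real n * signed_error \<alpha> m
     = of_int (int n * round (real m * \<alpha>) - int m * round (real n * \<alpha>))"
    by (simp add: signed_error_def algebra_simps)
  then show ?thesis by (metis Ints_of_int)
qed

lemma consec_error_le:
  assumes "consec \<alpha> q r" "1 \<le> m" "m < r"
  shows "error \<alpha> q \<le> error \<alpha> m"
proof -
  have "psi \<alpha> (r - 1) = error \<alpha> q"
    using consecD(3)[OF assms(1)] by (intro psi_consec[OF assms(1)]) auto
  then show ?thesis using psi_le[of m "r - 1" \<alpha>] assms by simp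
qed

text \<open>With equal signs the two signed errors would differ by less than
  \<open>error \<alpha> q\<close>, so \<open>r - q\<close> would beat \<open>q\<close> although it
  is below \<open>r\<close>.\<close>

lemma consec_opposite:
  assumes "\<alpha> \<notin> \<rat>" "consec \<alpha> q r"
  shows "signed_error \<alpha> q * signed_error \<alpha> r < 0"
proof (rule ccontr)
  note c = consecD[OF assms(2)]
  assume *: "\<not> signed_error \<alpha> q * signed_error \<alpha> r < 0"
  have "signed_error \<alpha> q \<noteq> 0" "signed_error \<alpha> r \<noteq> 0"
    using error_pos[OF assms(1), of q] error_pos[OF assms(1), of r] c by (auto simp: error_def)
  then have "\<bar>signed_error \<alpha> r - signed_error \<alpha> q\<bar> < error \<alpha> q"
    using * c(5) unfolding error_def by (smt (verit) mult_neg_pos mult_pos_neg)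
  then have "error \<alpha> (r - q) < error \<alpha> q"
    using error_diff_le[of q r \<alpha>] c(3) by simp
  then show False using consec_error_le[OF assms(2), of "r - q"] c(3,4) by linarith
qed

text \<open>Because of the opposite signs the left side is the absolute value of an integer
  determinant. It is positive and, by Dirichlet's theorem for \<open>r\<close>, less than 2.\<close>

lemma consec_identity:
  assumes "\<alpha> \<notin> \<rat>" "consec \<alpha> q r"
  shows "real r * error \<alpha> q + real q * error \<alpha> r = 1"
proof -
  note c = consecD[OF assms(2)]
  define d where "d = real r * signed_error \<alpha> q - real q * signed_error \<alpha> r"
  have pos: "0 < error \<alpha> q" "0 < error \<alpha> r"
    using error_pos[OF assms(1)] c by auto
  have nonneg: "0 \<le> real r * error \<alpha> q + real q * error \<alpha> r"
    using pos by simp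
  have abs: "\<bar>d\<bar> = real r * error \<alpha> q + real q * error \<alpha> r"
  proof (cases "0 < signed_error \<alpha> q")
    case True
    then have "signed_error \<alpha> r < 0"
      using consec_opposite[OF assms] by (simp add: mult_less_0_iff)
    then have "d = real r * error \<alpha> q + real q * error \<alpha> r"
      using True by (simp add: error_def d_def)
    then show ?thesis using nonneg by simp
  next
    case False
    then have "signed_error \<alpha> q < 0" "0 < signed_error \<alpha> r"
      using consec_opposite[OF assms] by (auto simp: mult_less_0_iff)
    then have "d = - (real r * error \<alpha> q + real q * error \<alpha> r)"
      by (simp add: error_def d_def)
    then show ?thesis using nonneg by (simp only: abs_minus_cancel abs_of_nonneg)
  qed
  obtain m where m: "1 \<le> m" "m < r" "error \<alpha> m \<le> 1 / real r"
    using dirichlet_error[of r \<alpha>] c by auto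
  have le: "error \<alpha> q \<le> 1 / real r"
    using consec_error_le[OF assms(2) m(1,2)] m(3) by simp
  then have "real r * error \<alpha> q \<le> 1" using c by (simp add: field_simps)
  moreover have "real q * error \<alpha> r < 1"
  proof -
    have "real q * error \<alpha> r < real r * error \<alpha> q"
      using c pos by (intro mult_strict_mono) auto
    then show ?thesis using \<open>real r * error \<alpha> q \<le> 1\<close> by simp
  qed
  ultimately have "\<bar>d\<bar> < 2" using abs by linarith
  moreover have "0 < \<bar>d\<bar>"
    using abs pos c by (simp add: add_pos_pos)
  moreover have "\<bar>d\<bar> \<in> \<int>" using det_Ints[of r \<alpha> q] by (simp add: d_def)
  then obtain k :: int where "\<bar>d\<bar> = of_int k" by (auto elim: Ints_cases)
  ultimately have "\<bar>d\<bar> = 1" by simp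
  then show ?thesis using abs by simp
qed

lemma consec_mult_less_1:
  assumes "\<alpha> \<notin> \<rat>" "consec \<alpha> q r"
  shows "real r * error \<alpha> q < 1"
proof -
  have "0 < real q * error \<alpha> r"
    using consecD(1-4)[OF assms(2)] error_pos[OF assms(1), of r] by simp
  then show ?thesis using consec_identity[OF assms] by linarith
qed

text \<open>By \<open>consec_identity\<close> the points belonging to \<open>q\<close> and
  \<open>r\<close> form a lattice basis, and \<open>u\<close>, \<open>v\<close> are the coordinates
  of the point of \<open>t\<close>. They are positive because errors of best denominators decrease.
  If \<open>t\<close> directly follows \<open>r\<close>, then \<open>v\<close> is itself the
  determinant of a consecutive pair.\<close>

lemma best_decompose:
  assumes irr: "\<alpha> \<notin> \<rat>" and qr: "consec \<alpha> q r" and t: "best \<alpha> t" "r < t"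
  obtains u v :: nat where "1 \<le> u" "1 \<le> v" "t = u * r + v * q"
    "real t * error \<alpha> q \<le> real u + real q * error \<alpha> t"
    "consec \<alpha> r t \<longrightarrow> v = 1 \<and> error \<alpha> q = real u * error \<alpha> r + error \<alpha> t"
proof -
  note c = consecD[OF qr]
  \<comment> \<open>The factor \<open>s\<close> normalises the signs: the error at \<open>q\<close>
    becomes positive and the one at \<open>r\<close> negative.\<close>
  define s where "s = sgn (signed_error \<alpha> q)"
  have pos: "0 < error \<alpha> q" "0 < error \<alpha> r" "0 < error \<alpha> t"
    using error_pos[OF irr] c t by auto
  have s: "s = 1 \<or> s = -1"
    using pos(1) by (auto simp: s_def sgn_if error_def)
  have sq: "s * signed_error \<alpha> q = error \<alpha> q"
    by (simp add: s_def error_def abs_sgn mult.commute)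
  have sr: "s * signed_error \<alpha> r = - error \<alpha> r"
    using consec_opposite[OF irr qr] by (auto simp: s_def error_def sgn_if mult_less_0_iff abs_if)
  have st: "\<bar>s * signed_error \<alpha> t\<bar> = error \<alpha> t"
    using s by (auto simp: error_def)
  have id: "real r * error \<alpha> q + real q * error \<alpha> r = 1"
    by (rule consec_identity[OF irr qr])
  \<comment> \<open>Cramer's rule for the coordinates \<open>u\<close> and \<open>v\<close>.\<close>
  define U where "U = s * (real t * signed_error \<alpha> q - real q * signed_error \<alpha> t)"
  define V where "V = - s * (real t * signed_error \<alpha> r - real r * signed_error \<alpha> t)"
  have U: "U = real t * error \<alpha> q - real q * (s * signed_error \<alpha> t)"
    unfolding U_def sq[symmetric] by (simp add: algebra_simps)
  have V: "V = real t * error \<alpha> r + real r * (s * signed_error \<alpha> t)"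
  proof -
    have "V = real t * (- (s * signed_error \<alpha> r)) + real r * (s * signed_error \<alpha> t)"
      unfolding V_def by (simp add: algebra_simps)
    then show ?thesis using sr by simp
  qed
  have less: "real q * error \<alpha> t < real t * error \<alpha> q" "real r * error \<alpha> t < real t * error \<alpha> r"
    using c t pos best_error_less[OF c(1) t(1)] best_error_less[OF c(2) t(1)]
    by (auto intro!: mult_strict_mono)
  have "real q * (s * signed_error \<alpha> t) \<le> real q * error \<alpha> t"
    using st by (intro mult_left_mono) auto
  then have Upos: "0 < U" using less U by linarith
  have "real r * (- (s * signed_error \<alpha> t)) \<le> real r * error \<alpha> t"
    using st by (intro mult_left_mono) auto
  then have Vpos: "0 < V" using less V by (simp add: algebra_simps)
  have "s \<in> \<int>" using s by auto
  then have "U \<in> \<int>" "V \<in> \<int>"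
    using det_Ints unfolding U_def V_def by auto
  then have "U \<in> \<nat>" "V \<in> \<nat>"
    using Upos Vpos by (auto simp: Nats_altdef2)
  then obtain u v :: nat where uv: "U = real u" "V = real v"
    by (auto elim!: Nats_cases)
  have "U * real r + V * real q = real t * (real r * error \<alpha> q + real q * error \<alpha> r)"
    unfolding U V by (simp add: algebra_simps)
  then have "real t = real (u * r + v * q)"
    using id uv by simp
  then have teq: "t = u * r + v * q" by linarith
  have 2: "- (real q * (s * signed_error \<alpha> t)) \<le> real q * error \<alpha> t \<and>
           real q * (s * signed_error \<alpha> t) \<le> real q * error \<alpha> t"
    using st mult_left_mono[of "s * signed_error \<alpha> t" "error \<alpha> t" "real q"]
      mult_left_mono[of "- (s * signed_error \<alpha> t)" "error \<alpha> t" "real q"] by auto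
  have 1: "real t * error \<alpha> q \<le> real u + real q * error \<alpha> t"
    using U 2 uv by linarith
  have 3: "v = 1 \<and> error \<alpha> q = real u * error \<alpha> r + error \<alpha> t" if rt: "consec \<alpha> r t"
  proof -
    have "s * signed_error \<alpha> t = error \<alpha> t"
      using s sr st consec_opposite[OF irr rt] pos
      by (auto simp: error_def abs_if mult_less_0_iff split: if_splits)
    then have "V = 1" using V consec_identity[OF irr rt] by simp
    \<comment> \<open>The identities for \<open>q\<close>, \<open>r\<close> and for
      \<open>r\<close>, \<open>t\<close> turn the two brackets into products, after which the terms
      cancel.\<close>
    moreover have "error \<alpha> q - U * error \<alpha> r - error \<alpha> t
        = error \<alpha> q * (1 - real t * error \<alpha> r) - error \<alpha> t * (1 - real q * error \<alpha> r)"
      unfolding U \<open>s * signed_error \<alpha> t = error \<alpha> t\<close> by (simp add: algebra_simps)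
    moreover have "\<dots> = error \<alpha> q * (real r * error \<alpha> t) - error \<alpha> t * (real r * error \<alpha> q)"
    proof -
      have "1 - real t * error \<alpha> r = real r * error \<alpha> t" "1 - real q * error \<alpha> r = real r * error \<alpha> q"
        using id consec_identity[OF irr rt] by linarith+
      then show ?thesis by simp
    qed
    ultimately show ?thesis using uv by simp
  qed
  have "1 \<le> u" "1 \<le> v" using Upos Vpos uv by auto
  then show thesis using that teq 1 3 by blast
qed

text \<open>The recurrence of continued fractions, with \<open>f\<close> the partial
  quotient.\<close>

lemma consec_recurrence:
  assumes "\<alpha> \<notin> \<rat>" "consec \<alpha> a b" "consec \<alpha> b c"
  obtains f :: nat where "1 \<le> f" "c = f * b + a" "error \<alpha> a = real f * error \<alpha> b + error \<alpha> c"
proof -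
  obtain u v :: nat where "1 \<le> u" "1 \<le> v" "c = u * b + v * a"
      "real c * error \<alpha> a \<le> real u + real a * error \<alpha> c"
      "consec \<alpha> b c \<longrightarrow> v = 1 \<and> error \<alpha> a = real u * error \<alpha> b + error \<alpha> c"
    by (rule best_decompose[OF assms(1,2) consecD(2,3)[OF assms(3)]])
  then show thesis using that assms(3) by simp
qed

text \<open>Since \<open>c \<ge> a + b\<close>, the product is at least the left side of the
  identity for \<open>a\<close>, \<open>b\<close>. Played against \<open>consec_mult_less_1\<close>,
  this prevents two jumps of one staircase from fitting under a single step of another.\<close>

lemma third_best_mult_ge_1:
  assumes "\<alpha> \<notin> \<rat>" "consec \<alpha> a b" "consec \<alpha> b c"
  shows "1 \<le> real c * error \<alpha> a"
proof -
  obtain f :: nat where f: "1 \<le> f" "c = f * b + a" "error \<alpha> a = real f * error \<alpha> b + error \<alpha> c"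
    by (rule consec_recurrence[OF assms])
  have "b + a \<le> c" using f by simp
  then have "real (b + a) * error \<alpha> a \<le> real c * error \<alpha> a"
    by (intro mult_right_mono) (auto simp: error_def)
  moreover have "real a * error \<alpha> b \<le> real a * error \<alpha> a"
    using consecD(5)[OF assms(2)] by (intro mult_left_mono) auto
  ultimately show ?thesis
    using consec_identity[OF assms(1,2)] by (simp add: algebra_simps)
qed

section \<open>No staircase stays below another for ever\<close>

text \<open>If \<beta> stayed strictly below \<alpha>, take late consecutive denominators
  \<open>a < b\<close> of \<beta>, the last denominator \<open>r \<ge> a\<close> of \<alpha> before
  \<open>b\<close>, and its successor \<open>r' \<ge> b\<close>. Both identities have the value 1,
  so \<open>error \<beta> a < error \<alpha> r\<close> forces
  \<open>error \<alpha> r' < error \<beta> b\<close>. Hence \<beta> jumps again at some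
  \<open>c \<le> r'\<close>, and \<open>c * error \<beta> a \<ge> 1\<close> contradicts
  \<open>r' * error \<alpha> r < 1\<close>.\<close>

lemma ex_not_dominated:
  assumes irr: "\<alpha> \<notin> \<rat>" "\<beta> \<notin> \<rat>"
  shows "\<exists>n\<ge>N. psi \<alpha> n \<le> psi \<beta> n"
proof (rule ccontr)
  assume "\<not> ?thesis"
  then have dom: "psi \<beta> n < psi \<alpha> n" if "N \<le> n" for n
    using that by (meson not_le)
  obtain q where q: "N + 1 < q" "best \<alpha> q"
    using ex_best_greater[OF irr(1)] by blast
  obtain a b where ab: "consec \<beta> a b" "a \<le> q" "q < b"
    using ex_consec_above[OF irr(2), of q] q by auto
  obtain r where r: "best \<alpha> r" "r < b" "\<And>m. best \<alpha> m \<Longrightarrow> m < b \<Longrightarrow> m \<le> r"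
    using ex_pred[of b \<alpha>] ab q by auto
  obtain r' where rr': "consec \<alpha> r r'"
    using ex_consec_succ[OF irr(1) r(1)] by blast
  have "q \<le> r" using r(3) q ab by blast
  have "b \<le> r'" using r(3)[of r'] consecD(2,3)[OF rr'] by linarith
  have "psi \<beta> r = error \<beta> a"
    using psi_consec[OF ab(1), of r] ab r \<open>q \<le> r\<close> by simp
  then have ar: "error \<beta> a < error \<alpha> r"
    using dom[of r] psi_best[OF r(1)] \<open>q \<le> r\<close> q by simp
  have pos: "0 < error \<beta> b" "0 < error \<alpha> r'" "0 < error \<beta> a"
    using error_pos[OF irr(1)] error_pos[OF irr(2)] consecD(3,4)[OF ab(1)] consecD(3,4)[OF rr'] by auto
  have "real b * error \<beta> a < real r' * error \<alpha> r"
    using ar \<open>b \<le> r'\<close> pos ab(3) by (intro mult_le_less_imp_less) auto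
  then have "real r * error \<alpha> r' < real a * error \<beta> b"
    using consec_identity[OF irr(2) ab(1)] consec_identity[OF irr(1) rr'] by linarith
  also have "\<dots> \<le> real r * error \<beta> b"
    using pos ab(2) \<open>q \<le> r\<close> by (intro mult_right_mono) auto
  finally have "error \<alpha> r' < error \<beta> b"
    by (simp add: mult_less_cancel_left)
  obtain c where bc: "consec \<beta> b c"
    using ex_consec_succ[OF irr(2) consecD(2)[OF ab(1)]] by blast
  \<comment> \<open>Otherwise \<beta> would still have the value \<open>error \<beta> b\<close> at
    \<open>r'\<close> and lie above \<alpha> there.\<close>
  have "c \<le> r'"
  proof (rule ccontr)
    assume "\<not> c \<le> r'"
    then have "psi \<beta> r' = error \<beta> b"
      using psi_consec[OF bc \<open>b \<le> r'\<close>] by simp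
    then show False
      using dom[of r'] psi_best[OF consecD(2)[OF rr']] \<open>error \<alpha> r' < error \<beta> b\<close> q ab \<open>b \<le> r'\<close>
      by simp
  qed
  then have "real c * error \<beta> a \<le> real r' * error \<alpha> r"
    using ar pos by (intro mult_mono) auto
  then show False
    using third_best_mult_ge_1[OF irr(2) ab(1) bc] consec_mult_less_1[OF irr(1) rr'] by linarith
qed

section \<open>Consecutive pairs shared by two numbers\<close>

lemma consec_pred_mod:
  assumes "\<alpha> \<notin> \<rat>" "consec \<alpha> a b" "consec \<alpha> b c"
  shows "a = c mod b"
proof -
  obtain f :: nat where f: "1 \<le> f" "c = f * b + a" "error \<alpha> a = real f * error \<alpha> b + error \<alpha> c"
    by (rule consec_recurrence[OF assms])
  show ?thesis using f(2) consecD(3)[OF assms(2)] by simp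
qed

text \<open>Two consecutive denominators determine all earlier ones, by the Euclidean algorithm.\<close>

lemma common_consec_imp_common_past:
  assumes irr: "\<alpha> \<notin> \<rat>" "\<beta> \<notin> \<rat>"
  shows "consec \<alpha> s t \<Longrightarrow> consec \<beta> s t \<Longrightarrow> m \<le> t \<Longrightarrow> best \<alpha> m \<longleftrightarrow> best \<beta> m"
proof (induction t arbitrary: s m rule: less_induct)
  case (less t)
  note c = consecD[OF less.prems(1)] and d = consecD[OF less.prems(2)]
  have below: "best \<alpha> m \<longleftrightarrow> best \<beta> m" if "m \<le> s"
  proof (cases "s = 1")
    case True
    then show ?thesis
      using that best_1 best_ge_1 by (metis le_antisym)
  next
    case False
    then have "1 < s" using c(4) by simp
    then obtain a b where ab: "consec \<alpha> a s" "consec \<beta> b s"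
      using ex_consec_pred c(1) d(1) by blast
    then have "a = b"
      using consec_pred_mod irr less.prems(1,2) by metis
    then show ?thesis
      using less.IH[of s a m] ab c(3) that by blast
  qed
  consider "m \<le> s" | "s < m" "m < t" | "m = t"
    using less.prems(3) by linarith
  then show ?case
  proof cases
    case 2
    then show ?thesis using less.prems(1,2) by (simp add: consec_def)
  qed (use below c(2) d(2) in auto)
qed

text \<open>Arbitrarily late common pairs would make all denominators common. Subtracting the two
  identities for a pair \<open>s\<close>, \<open>t\<close> then gives
  \<open>t * \<delta> s = s * \<delta> t\<close>, so the distance \<open>\<delta>\<close> of the
  errors never decreases from one denominator to the next, although
  \<open>t * \<delta> t < 1\<close>.\<close>

lemma eventually_no_common_consec:
  assumes irr: "\<alpha> \<notin> \<rat>" "\<beta> \<notin> \<rat>" and ne: "\<And>n. N \<le> n \<Longrightarrow> psi \<alpha> n \<noteq> psi \<beta> n"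
  shows "\<exists>T. \<forall>s t. T \<le> t \<longrightarrow> \<not> (consec \<alpha> s t \<and> consec \<beta> s t)"
proof (rule ccontr)
  assume no: "\<not> ?thesis"
  have best_eq: "best \<alpha> m \<longleftrightarrow> best \<beta> m" for m
  proof -
    obtain s t where "m \<le> t" "consec \<alpha> s t" "consec \<beta> s t" using no by blast
    then show ?thesis using common_consec_imp_common_past[OF irr] by blast
  qed
  then have consec_eq: "consec \<alpha> s t \<longleftrightarrow> consec \<beta> s t" for s t
    by (simp add: consec_def)
  define \<delta> where "\<delta> t = \<bar>error \<alpha> t - error \<beta> t\<bar>" for t
  obtain s0 where s0: "N < s0" "best \<alpha> s0"
    using ex_best_greater[OF irr(1)] by blast
  have "0 < \<delta> s0"
    using ne[of s0] s0 psi_best best_eq by (simp add: \<delta>_def)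
  have grow: "\<delta> s0 \<le> \<delta> t" if "best \<alpha> t" "s0 \<le> t" for t
    using that
  proof (induction t rule: less_induct)
    case (less t)
    show ?case
    proof (cases "t = s0")
      case False
      then have "s0 < t" using less.prems by simp
      then obtain s where s: "consec \<alpha> s t"
        using ex_consec_pred[OF less.prems(1)] best_ge_1[OF s0(2)] by auto
      note c = consecD[OF s]
      have "s0 \<le> s" using c(6)[OF s0(2) \<open>s0 < t\<close>] .
      then have IH: "\<delta> s0 \<le> \<delta> s" using less.IH[OF c(3,1)] by simp
      have "real t * (error \<alpha> s - error \<beta> s) = - (real s * (error \<alpha> t - error \<beta> t))"
        using consec_identity[OF irr(1) s] consec_identity[OF irr(2) s[unfolded consec_eq]]
        by (simp add: algebra_simps)
      then have "\<bar>real t * (error \<alpha> s - error \<beta> s)\<bar> = \<bar>real s * (error \<alpha> t - error \<beta> t)\<bar>"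
        by simp
      then have "real t * \<delta> s = real s * \<delta> t"
        by (simp add: \<delta>_def abs_mult)
      moreover have "real s * \<delta> s \<le> real t * \<delta> s"
        using c(3) by (intro mult_right_mono) (auto simp: \<delta>_def)
      ultimately have "real s * \<delta> s \<le> real s * \<delta> t" by simp
      then show ?thesis using c(4) IH by simp
    qed simp
  qed
  \<comment> \<open>Any denominator \<open>t\<close> beyond \<open>k\<close> has
    \<open>t * \<delta> t \<ge> k * \<delta> s0 > 1\<close>.\<close>
  obtain k :: nat where k: "1 / \<delta> s0 < real k" using reals_Archimedean2 by blast
  obtain t where t: "k + s0 < t" "best \<alpha> t"
    using ex_best_greater[OF irr(1)] by blast
  obtain r where r: "consec \<alpha> t r" using ex_consec_succ[OF irr(1) t(2)] by blast
  have small: "real t * error \<gamma> t < 1" if "\<gamma> \<notin> \<rat>" "consec \<gamma> t r" for \<gamma>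
  proof -
    have "real t * error \<gamma> t \<le> real r * error \<gamma> t"
      using consecD(3)[OF that(2)] by (intro mult_right_mono) (auto simp: error_def)
    then show ?thesis using consec_mult_less_1[OF that] by linarith
  qed
  have "real t * error \<alpha> t < 1" "real t * error \<beta> t < 1"
    using small irr r consec_eq by blast+
  moreover have "0 \<le> real t * error \<alpha> t" "0 \<le> real t * error \<beta> t"
    by (simp_all add: error_def)
  moreover have "real t * \<delta> t = \<bar>real t * error \<alpha> t - real t * error \<beta> t\<bar>"
    by (simp add: \<delta>_def abs_mult flip: right_diff_distrib)
  ultimately have "real t * \<delta> t < 1" by linarith
  moreover have "real k * \<delta> s0 \<le> real t * \<delta> t"
    using grow[OF t(2)] t(1) \<open>0 < \<delta> s0\<close> by (intro mult_mono) auto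
  moreover have "1 < real k * \<delta> s0"
    using k \<open>0 < \<delta> s0\<close> by (simp add: field_simps)
  ultimately show False by linarith
qed

section \<open>Crossing before a simultaneous jump\<close>

text \<open>Suppose \<beta>, the lower one just before \<open>t\<close>, was no higher than \<alpha>
  just before its own previous jump \<open>s\<close>. If \<open>q < s\<close>, then \<alpha> already
  has the value \<open>error \<alpha> q\<close> there, and
  \<open>t * error \<beta> s' \<ge> 1\<close> contradicts \<open>t * error \<alpha> q < 1\<close>.
  If \<open>s < q\<close>, the decompositions of \<open>t\<close> with respect to both numbers are
  compared.\<close>

lemma common_best_imp_crossing:
  assumes irr: "\<alpha> \<notin> \<rat>" "\<beta> \<notin> \<rat>"
    and A: "consec \<alpha> q t" and B: "consec \<beta> s t" "consec \<beta> s' s"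
    and low: "error \<beta> s < error \<alpha> q" and ne: "q \<noteq> s"
  shows "psi \<alpha> (s - 1) < psi \<beta> (s - 1)"
proof (rule ccontr)
  note cA = consecD[OF A] and cB = consecD[OF B(1)] and cB' = consecD[OF B(2)]
  have psiB: "psi \<beta> (s - 1) = error \<beta> s'"
    using psi_consec[OF B(2), of "s - 1"] cB'(3) by simp
  assume "\<not> psi \<alpha> (s - 1) < psi \<beta> (s - 1)"
  then have ge: "error \<beta> s' \<le> psi \<alpha> (s - 1)" using psiB by simp
  \<comment> \<open>If \<open>s < q\<close>, write \<open>t = u y + v x = f s + s'\<close>, where \<open>x < y\<close> are the consecutive denominators
    of \<open>\<alpha>\<close> with \<open>x < s \<le> y\<close>; comparing \<open>t\<close> times the errors of \<open>x\<close> and \<open>s'\<close> forces \<open>u = f\<close>.\<close>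
  consider "q < s" | "s < q" using ne by linarith
  then show False
  proof cases
    case 1
    then have "psi \<alpha> (s - 1) = error \<alpha> q"
      using psi_consec[OF A, of "s - 1"] cB(3) by simp
    then have "real t * error \<beta> s' \<le> real t * error \<alpha> q"
      using ge by (intro mult_left_mono) auto
    then show False
      using third_best_mult_ge_1[OF irr(2) B(2,1)] consec_mult_less_1[OF irr(1) A] by linarith
  next
    case 2
    have "1 < s" using cB'(3,4) by linarith
    have pos: "0 < error \<alpha> t" "0 < error \<beta> t"
      using error_pos irr best_ge_1[OF cA(2)] by auto
    have "1 \<le> s - 1" using \<open>1 < s\<close> by linarith
    then obtain x y where xy: "consec \<alpha> x y" "x \<le> s - 1" "s - 1 < y"
      using ex_consec_above[OF irr(1)] by blast
    note cx = consecD[OF xy(1)]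
    have "s \<le> y" using xy \<open>1 < s\<close> by linarith
    have "psi \<alpha> (s - 1) = error \<alpha> x" using psi_consec[OF xy] .
    have "y \<le> q" using cx(7)[OF cA(1)] xy 2 \<open>1 < s\<close> by linarith
    then have "y < t" using cA(3) by linarith
    obtain u v where uv: "1 \<le> u" "1 \<le> v" "t = u * y + v * x"
        "real t * error \<alpha> x \<le> real u + real x * error \<alpha> t"
        "consec \<alpha> y t \<longrightarrow> v = 1 \<and> error \<alpha> x = real u * error \<alpha> y + error \<alpha> t"
      by (rule best_decompose[OF irr(1) xy(1) cA(2) \<open>y < t\<close>])
    obtain f where f: "1 \<le> f" "t = f * s + s'" "error \<beta> s' = real f * error \<beta> s + error \<beta> t"
      by (rule consec_recurrence[OF irr(2) B(2,1)])
    \<comment> \<open>Applying the recurrence to the second \<open>error \<beta> s'\<close> only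
      produces \<open>f\<close> copies of the identity for \<open>s'\<close>,
      \<open>s\<close>.\<close>
    have "real t * error \<beta> s' = real f * (real s * error \<beta> s') + real s' * error \<beta> s'"
      using f(2) by (simp add: algebra_simps)
    also have "\<dots> = real f * (real s * error \<beta> s' + real s' * error \<beta> s) + real s' * error \<beta> t"
      by (subst (2) f(3)) (simp add: algebra_simps)
    also have "\<dots> = real f + real s' * error \<beta> t"
      using consec_identity[OF irr(2) B(2)] by simp
    finally have eqB: "real t * error \<beta> s' = real f + real s' * error \<beta> t" .
    have "real t * error \<beta> s' \<le> real t * error \<alpha> x"
      using ge \<open>psi \<alpha> (s - 1) = error \<alpha> x\<close> by (intro mult_left_mono) auto
    then have le: "real f + real s' * error \<beta> t \<le> real u + real x * error \<alpha> t"
      using eqB uv(4) by linarith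
    have "real x * error \<alpha> t < 1"
    proof -
      have "real x * error \<alpha> t \<le> real t * error \<alpha> q"
        using cx(3) \<open>y < t\<close> cA(5) pos by (intro mult_mono) auto
      then show ?thesis using consec_mult_less_1[OF irr(1) A] by linarith
    qed
    moreover have "0 < real s' * error \<beta> t" using pos cB'(4) by simp
    ultimately have "real f < real u + 1" using le by linarith
    then have "f \<le> u" by linarith
    \<comment> \<open>Otherwise \<open>(f + 1) * s \<le> u * y \<le> t\<close>, although
      \<open>t = f * s + s'\<close> with \<open>s' < s\<close>.\<close>
    moreover have "\<not> f < u"
    proof
      assume "f < u"
      then have "(f + 1) * s \<le> u * y" using \<open>s \<le> y\<close> by (intro mult_mono) auto
      then show False using f(2) uv(3) cB'(3) by simp
    qed
    ultimately have "f = u" by simp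
    \<comment> \<open>With \<open>f = u\<close>, the bound \<open>le\<close> reads
      \<open>s' * error \<beta> t \<le> x * error \<alpha> t\<close>. It is refuted by
      \<open>x \<le> s'\<close> together with
      \<open>error \<alpha> t < error \<beta> t\<close>.\<close>
    have "u * s \<le> u * y" using \<open>s \<le> y\<close> by simp
    moreover have "u * s + s' = u * y + v * x" using f(2) uv(3) \<open>f = u\<close> by simp
    ultimately have "v * x \<le> s'" by linarith
    moreover have "1 * x \<le> v * x" using uv(2) by (intro mult_right_mono) auto
    ultimately have "x \<le> s'" by linarith
    have "real t * error \<beta> s < real t * error \<alpha> q" using low cA(3) by simp
    then have "real q * error \<alpha> t < real s * error \<beta> t"
      using consec_identity[OF irr(1) A] consec_identity[OF irr(2) B(1)] by linarith
    also have "\<dots> \<le> real q * error \<beta> t" using 2 pos by (intro mult_right_mono) auto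
    finally have "error \<alpha> t < error \<beta> t" by (simp add: mult_less_cancel_left)
    then have "real x * error \<alpha> t < real s' * error \<beta> t"
      using \<open>x \<le> s'\<close> cx(4) pos by (intro mult_le_less_imp_less) auto
    then show False using le \<open>f = u\<close> by simp
  qed
qed

section \<open>Counting rankings\<close>

text \<open>A set of pairs instead of a permutation, so that deleting functions amounts to
  intersecting with a smaller square.\<close>

definition ranking :: "('a \<Rightarrow> real) \<Rightarrow> 'a set \<Rightarrow> nat \<Rightarrow> ('a \<times> 'a) set" where
  "ranking \<alpha> S t = {(i, j). i \<in> S \<and> j \<in> S \<and> psi (\<alpha> i) t < psi (\<alpha> j) t}"

lemma finite_rankings: "finite S \<Longrightarrow> finite (ranking \<alpha> S ` A)"
  by (rule finite_subset[of _ "Pow (S \<times> S)"]) (auto simp: ranking_def)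

text \<open>
  The simultaneous jumps at time \<open>t\<close> are separated by their predecessors: every jumping function but
  the topmost one, \<open>i0\<close>, falls below \<open>i0\<close> exactly at its previous jump and stays there until \<open>t\<close>,
  so the rankings just before these previous jumps, and just before \<open>t\<close>, are pairwise different.
\<close>

lemma card_jumps_le_card_rankings:
  fixes S :: "'a set"
  assumes fin: "finite S" and irr: "\<And>i. i \<in> S \<Longrightarrow> \<alpha> i \<notin> \<rat>"
    and distinct: "\<And>i j n. i \<in> S \<Longrightarrow> j \<in> S \<Longrightarrow> i \<noteq> j \<Longrightarrow> T \<le> n \<Longrightarrow> psi (\<alpha> i) n \<noteq> psi (\<alpha> j) n"
    and no_common: "\<And>i j s t. i \<in> S \<Longrightarrow> j \<in> S \<Longrightarrow> i \<noteq> j \<Longrightarrow> T \<le> t \<Longrightarrow>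
      \<not> (consec (\<alpha> i) s t \<and> consec (\<alpha> j) s t)"
    and T: "1 \<le> T" and late: "\<And>i. i \<in> S \<Longrightarrow> \<exists>b. best (\<alpha> i) b \<and> T < b \<and> b < t"
  shows "card {i \<in> S. best (\<alpha> i) t} \<le> card (ranking \<alpha> S ` {T..})"
proof (cases "{i \<in> S. best (\<alpha> i) t} = {}")
  case False
  define J where "J = {i \<in> S. best (\<alpha> i) t}"
  have J: "finite J" "J \<noteq> {}" "J \<subseteq> S" using fin False by (auto simp: J_def)
  have "\<forall>i\<in>J. \<exists>s. consec (\<alpha> i) s t \<and> T < s"
  proof
    fix i assume "i \<in> J"
    \<comment> \<open>A denominator between \<open>T\<close> and \<open>t\<close> pushes the last
      jump before \<open>t\<close> beyond \<open>T\<close>, so the time just before that jump is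
      still at least \<open>T\<close>.\<close>
    obtain b where b: "best (\<alpha> i) b" "T < b" "b < t" using late \<open>i \<in> J\<close> J by blast
    then obtain s where s: "consec (\<alpha> i) s t"
      using ex_consec_pred[of "\<alpha> i" t] \<open>i \<in> J\<close> by (auto simp: J_def)
    then show "\<exists>s. consec (\<alpha> i) s t \<and> T < s"
      using consecD(6)[OF s b(1,3)] b(2) by (intro exI[of _ s]) auto
  qed
  then obtain p where p: "\<And>i. i \<in> J \<Longrightarrow> consec (\<alpha> i) (p i) t" "\<And>i. i \<in> J \<Longrightarrow> T < p i"
    by (auto dest!: bchoice)
  have p_lt: "p i < t" if "i \<in> J" for i using consecD(3)[OF p(1)[OF that]] .
  have "Max ((\<lambda>i. psi (\<alpha> i) (t - 1)) ` J) \<in> (\<lambda>i. psi (\<alpha> i) (t - 1)) ` J"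
    using J by (intro Max_in) auto
  then obtain i0 where i0: "i0 \<in> J" "psi (\<alpha> i0) (t - 1) = Max ((\<lambda>i. psi (\<alpha> i) (t - 1)) ` J)"
    by auto
  have const: "psi (\<alpha> i) n = error (\<alpha> i) (p i)" if "i \<in> J" "p i \<le> n" "n < t" for i n
    using psi_consec[OF p(1)] that by blast
  have top: "psi (\<alpha> i) (t - 1) < psi (\<alpha> i0) (t - 1)" if "i \<in> J" "i \<noteq> i0" for i
  proof -
    have "psi (\<alpha> i) (t - 1) \<le> psi (\<alpha> i0) (t - 1)"
      unfolding i0(2) using J that by (intro Max_ge) auto
    moreover have "T \<le> t - 1" using p(2)[OF that(1)] p_lt[OF that(1)] by linarith
    then have "psi (\<alpha> i) (t - 1) \<noteq> psi (\<alpha> i0) (t - 1)"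
      using distinct that J i0 by blast
    ultimately show ?thesis by simp
  qed
  have p_ne: "p i \<noteq> p j" if "i \<in> J" "j \<in> J" "i \<noteq> j" for i j
  proof
    assume "p i = p j"
    then have "consec (\<alpha> i) (p i) t \<and> consec (\<alpha> j) (p i) t"
      using p(1)[OF that(1)] p(1)[OF that(2)] by simp
    moreover have "T \<le> t" using p(2)[OF that(1)] p_lt[OF that(1)] by linarith
    ultimately show False using no_common that J by blast
  qed
  have above: "(i0, i) \<in> ranking \<alpha> S (p i - 1)" if "i \<in> J" "i \<noteq> i0" for i
  proof -
    have "1 < p i" using p(2)[OF that(1)] T by linarith
    moreover have "best (\<alpha> i) (p i)" using consecD(1)[OF p(1)[OF that(1)]] .
    ultimately obtain s' where s': "consec (\<alpha> i) s' (p i)"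
      using ex_consec_pred by blast
    have "error (\<alpha> i) (p i) < error (\<alpha> i0) (p i0)"
      using top[OF that] const[of i "t - 1"] const[of i0 "t - 1"] that i0 p_lt[of i] p_lt[of i0] by simp
    then have "psi (\<alpha> i0) (p i - 1) < psi (\<alpha> i) (p i - 1)"
      using common_best_imp_crossing[OF _ _ p(1)[OF i0(1)] p(1)[OF that(1)] s'] that i0(1) irr J p_ne
      by blast
    then show ?thesis using that i0 J by (auto simp: ranking_def)
  qed
  \<comment> \<open>From \<open>p i\<close> on, \<open>i\<close> is constant until \<open>t\<close>
    while \<open>i0\<close> can only sink, and at \<open>t - 1\<close> it is still above
    \<open>i\<close>.\<close>
  have below: "(i0, i) \<notin> ranking \<alpha> S n" if "i \<in> J" "i \<noteq> i0" "p i \<le> n" "n < t" for i n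
  proof -
    have "1 \<le> n" using p(2)[OF that(1)] that(3) T by linarith
    then have "psi (\<alpha> i0) (t - 1) \<le> psi (\<alpha> i0) n"
      using that(4) by (intro psi_antimono) auto
    moreover have "psi (\<alpha> i) n = psi (\<alpha> i) (t - 1)"
      using const[of i] that by simp
    ultimately show ?thesis using top[OF that(1,2)] by (auto simp: ranking_def)
  qed
  define \<tau> where "\<tau> i = (if i = i0 then t - 1 else p i - 1)" for i
  have \<tau>_bounds: "T \<le> \<tau> i \<and> \<tau> i < t" if "i \<in> J" for i
    using p(2)[OF that] p_lt[OF that] by (auto simp: \<tau>_def)
  have \<tau>_ne: "\<tau> i \<noteq> \<tau> j" if "i \<in> J" "j \<in> J" "i \<noteq> j" for i j
    using p(2)[OF that(1)] p(2)[OF that(2)] p_lt[OF that(1)] p_lt[OF that(2)] p_ne[OF that] that(3)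
    by (auto simp: \<tau>_def)
  \<comment> \<open>The earlier time belongs to some \<open>i \<noteq> i0\<close>, since
    \<open>i0\<close> has the latest possible time \<open>t - 1\<close>. The pair
    \<open>(i0, i)\<close> is present at that time and absent at the later one.\<close>
  have less_ne: "ranking \<alpha> S (\<tau> i) \<noteq> ranking \<alpha> S (\<tau> j)" if "i \<in> J" "j \<in> J" "\<tau> i < \<tau> j" for i j
  proof -
    have "i \<noteq> i0" using that(3) \<tau>_bounds[OF that(2)] by (auto simp: \<tau>_def)
    then have "\<tau> i = p i - 1" by (simp add: \<tau>_def)
    then have "p i \<le> \<tau> j" using that(3) by linarith
    then show ?thesis
      using above[OF that(1) \<open>i \<noteq> i0\<close>] below[OF that(1) \<open>i \<noteq> i0\<close>, of "\<tau> j"] \<tau>_bounds[OF that(2)]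
        \<open>\<tau> i = p i - 1\<close> by auto
  qed
  have "inj_on (\<lambda>i. ranking \<alpha> S (\<tau> i)) J"
  proof (rule inj_onI, rule ccontr)
    fix i j assume "i \<in> J" "j \<in> J" "ranking \<alpha> S (\<tau> i) = ranking \<alpha> S (\<tau> j)" "i \<noteq> j"
    then show False using \<tau>_ne[of i j] less_ne[of i j] less_ne[of j i] by (cases "\<tau> i < \<tau> j") auto
  qed
  then have "card J = card ((\<lambda>i. ranking \<alpha> S (\<tau> i)) ` J)" by (simp add: card_image)
  also have "\<dots> \<le> card (ranking \<alpha> S ` {T..})"
    using \<tau>_bounds by (intro card_mono finite_rankings fin) auto
  finally show ?thesis by (simp add: J_def)
qed (simp only: card.empty le0)

text \<open>\<open>psi\<close> moves only at best denominators. The bound \<open>2 \<le> t\<close>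
  keeps \<open>t - 1\<close> away from 0, where \<open>psi\<close> is the minimum of the empty
  set.\<close>

lemma ranking_eq_if_no_jump:
  assumes "2 \<le> t" "\<And>i. i \<in> S \<Longrightarrow> \<not> best (\<alpha> i) t"
  shows "ranking \<alpha> S (t - 1) = ranking \<alpha> S t"
  using psi_not_best[OF assms(1)] assms(2) by (auto simp: ranking_def)

text \<open>A constant ranking would keep one of \<open>i\<close>, \<open>j\<close> below the other
  for ever, against \<open>ex_not_dominated\<close>.\<close>

lemma ex_ranking_change:
  assumes "i \<in> S" "j \<in> S" "\<alpha> i \<notin> \<rat>" "\<alpha> j \<notin> \<rat>"
    and ne: "\<And>n. N \<le> n \<Longrightarrow> psi (\<alpha> i) n \<noteq> psi (\<alpha> j) n"
  shows "\<exists>t>N. ranking \<alpha> S (t - 1) \<noteq> ranking \<alpha> S t"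
proof (rule ccontr)
  assume *: "\<not> ?thesis"
  have const: "ranking \<alpha> S n = ranking \<alpha> S N" if "N \<le> n" for n
    using that
  proof (induction n rule: dec_induct)
    case (step n)
    have "ranking \<alpha> S (Suc n - 1) = ranking \<alpha> S (Suc n)"
      using * step.hyps(1) le_imp_less_Suc by blast
    then show ?case using step.IH by simp
  qed simp
  have same: "psi (\<alpha> a) n < psi (\<alpha> b) n \<longleftrightarrow> psi (\<alpha> a) N < psi (\<alpha> b) N"
    if "a \<in> S" "b \<in> S" "N \<le> n" for a b n
  proof -
    have "(a, b) \<in> ranking \<alpha> S n \<longleftrightarrow> (a, b) \<in> ranking \<alpha> S N" using const[OF that(3)] by simp
    then show ?thesis using that by (simp add: ranking_def)
  qed
  obtain n m where "N \<le> n" "psi (\<alpha> i) n \<le> psi (\<alpha> j) n" "N \<le> m" "psi (\<alpha> j) m \<le> psi (\<alpha> i) m"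
    using ex_not_dominated[OF assms(3,4)] ex_not_dominated[OF assms(4,3)] by metis
  then have "psi (\<alpha> i) n < psi (\<alpha> j) n" "psi (\<alpha> j) m < psi (\<alpha> i) m"
    using ne[of n] ne[of m] by simp_all
  then have "psi (\<alpha> i) N < psi (\<alpha> j) N" "psi (\<alpha> j) N < psi (\<alpha> i) N"
    using same assms(1,2) \<open>N \<le> n\<close> \<open>N \<le> m\<close> by blast+
  then show False by simp
qed

text \<open>
  Deleting the functions that jump at a change of the ranking merges two rankings, and by
  \<open>card_jumps_le_card_rankings\<close> it deletes at most \<open>k\<close> functions if there are \<open>k\<close> rankings.
\<close>

lemma card_le_triangle_rankings:
  fixes S :: "'a set"
  assumes "finite S" "\<And>i. i \<in> S \<Longrightarrow> \<alpha> i \<notin> \<rat>" "1 \<le> T"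
    and "\<And>i j n. i \<in> S \<Longrightarrow> j \<in> S \<Longrightarrow> i \<noteq> j \<Longrightarrow> T \<le> n \<Longrightarrow> psi (\<alpha> i) n \<noteq> psi (\<alpha> j) n"
    and "\<And>i j s t. i \<in> S \<Longrightarrow> j \<in> S \<Longrightarrow> i \<noteq> j \<Longrightarrow> T \<le> t \<Longrightarrow>
      \<not> (consec (\<alpha> i) s t \<and> consec (\<alpha> j) s t)"
  shows "2 * card S \<le> card (ranking \<alpha> S ` {T..}) * (card (ranking \<alpha> S ` {T..}) + 1)"
  using assms
proof (induction S rule: finite_psubset_induct)
  case (psubset S)
  define k where "k = card (ranking \<alpha> S ` {T..})"
  have "k \<noteq> 0" using finite_rankings[OF psubset.hyps] by (auto simp: k_def)
  show ?case
  proof (cases "card S \<le> 1")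
    case True
    moreover have "1 * 2 \<le> k * (k + 1)" using \<open>k \<noteq> 0\<close> by (intro mult_le_mono) auto
    ultimately show ?thesis by (simp add: k_def)
  next
    case False
    then obtain i j where ij: "i \<in> S" "j \<in> S" "i \<noteq> j"
      using card_le_Suc0_iff_eq[OF psubset.hyps] by auto
    have "\<forall>i\<in>S. \<exists>b. T < b \<and> best (\<alpha> i) b"
      using ex_best_greater psubset.prems(1) by blast
    then obtain b where b: "\<And>i. i \<in> S \<Longrightarrow> T < b i \<and> best (\<alpha> i) (b i)"
      by metis
    \<comment> \<open>Beyond \<open>N\<close> every function has already jumped after
      \<open>T\<close>, as \<open>card_jumps_le_card_rankings\<close> demands.\<close>
    define N where "N = T + sum b S"
    have bN: "b i \<le> N" if "i \<in> S" for i
      using member_le_sum[of i S b] that psubset.hyps by (simp add: N_def)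
    obtain t where t: "N < t" "ranking \<alpha> S (t - 1) \<noteq> ranking \<alpha> S t"
      using ex_ranking_change[of i S j \<alpha> N] ij psubset.prems(1,3) by (force simp: N_def)
    define J where "J = {i \<in> S. best (\<alpha> i) t}"
    define S' where "S' = S - J"
    have "T < t" using t by (simp add: N_def)
    then have "2 \<le> t" using psubset.prems(2) by linarith
    then have "J \<noteq> {}" using ranking_eq_if_no_jump[of t S \<alpha>] t(2) by (auto simp: J_def)
    then have "S' \<subset> S" by (auto simp: S'_def J_def)
    have "card J \<le> k"
      unfolding J_def k_def
    proof (rule card_jumps_le_card_rankings[OF psubset.hyps psubset.prems(1,3,4,2)])
      fix i assume "i \<in> S"
      then show "\<exists>b. best (\<alpha> i) b \<and> T < b \<and> b < t"
        using b bN t(1) le_less_trans by blast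
    qed auto
    define k' where "k' = card (ranking \<alpha> S' ` {T..})"
    have IH: "2 * card S' \<le> k' * (k' + 1)"
      unfolding k'_def
    proof (rule psubset.IH[OF \<open>S' \<subset> S\<close>])
      have "S' \<subseteq> S" using \<open>S' \<subset> S\<close> by blast
      then show "\<And>i. i \<in> S' \<Longrightarrow> \<alpha> i \<notin> \<rat>"
        "\<And>i j n. i \<in> S' \<Longrightarrow> j \<in> S' \<Longrightarrow> i \<noteq> j \<Longrightarrow> T \<le> n \<Longrightarrow> psi (\<alpha> i) n \<noteq> psi (\<alpha> j) n"
        "\<And>i j s t. i \<in> S' \<Longrightarrow> j \<in> S' \<Longrightarrow> i \<noteq> j \<Longrightarrow> T \<le> t \<Longrightarrow>
          \<not> (consec (\<alpha> i) s t \<and> consec (\<alpha> j) s t)"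
        using psubset.prems by blast+
    qed (rule psubset.prems(2))
    define f where "f R = R \<inter> S' \<times> S'" for R
    have f: "ranking \<alpha> S' n = f (ranking \<alpha> S n)" for n
      using \<open>S' \<subset> S\<close> by (auto simp: ranking_def f_def)
    have img: "ranking \<alpha> S' ` {T..} = f ` (ranking \<alpha> S ` {T..})"
      by (simp add: image_image f)
    \<comment> \<open>No function of \<open>S'\<close> jumps at \<open>t\<close>, so the different
      rankings at \<open>t - 1\<close> and \<open>t\<close> have the same restriction to
      \<open>S'\<close>.\<close>
    have "\<not> inj_on f (ranking \<alpha> S ` {T..})"
    proof
      assume "inj_on f (ranking \<alpha> S ` {T..})"
      moreover have "f (ranking \<alpha> S (t - 1)) = f (ranking \<alpha> S t)"
        using ranking_eq_if_no_jump[OF \<open>2 \<le> t\<close>, of S' \<alpha>] unfolding f by (auto simp: S'_def J_def)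
      moreover have "t - 1 \<in> {T..}" "t \<in> {T..}" using \<open>T < t\<close> by auto
      ultimately show False using t(2) by (meson imageI inj_onD)
    qed
    then have "k' \<noteq> k"
      unfolding k'_def k_def img using eq_card_imp_inj_on finite_rankings[OF psubset.hyps] by blast
    moreover have "k' \<le> k"
      unfolding k'_def k_def img by (intro card_image_le finite_rankings psubset.hyps)
    \<comment> \<open>With \<open>m = k - 1\<close> the triangular numbers add up:
      \<open>2 * k + m * (m + 1) = k * (k + 1)\<close>.\<close>
    ultimately obtain m where m: "k = Suc m" "k' \<le> m" by (cases k) auto
    have "card S = card J + card S'"
      using psubset.hyps card_Diff_subset[of J S] card_mono[of S J]
      by (auto simp: S'_def J_def)
    moreover have "k' * (k' + 1) \<le> m * (m + 1)" using m by (intro mult_le_mono) auto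
    ultimately have "2 * card S \<le> 2 * k + m * (m + 1)" using IH \<open>card J \<le> k\<close> by linarith
    also have "\<dots> = k * (k + 1)" by (simp add: m(1) algebra_simps)
    finally show ?thesis by (simp add: k_def)
  qed
qed

section \<open>From integer times to the index \<open>k_index\<close>\<close>

lemma irrationality_measure_fun_eq_psi:
  "irrationality_measure_fun \<xi> (real n) = psi \<xi> n"
proof -
  have "{q :: int. 1 \<le> q \<and> of_int q \<le> real n} = int ` {1..n}"
  proof (intro equalityI subsetI)
    fix q :: int assume "q \<in> {q. 1 \<le> q \<and> of_int q \<le> real n}"
    then have "q = int (nat q)" "nat q \<in> {1..n}" by auto
    then show "q \<in> int ` {1..n}" by blast
  qed auto
  then have "(\<lambda>q. dist_nearest_int (of_int q * \<xi>)) ` {q :: int. 1 \<le> q \<and> of_int q \<le> real n} = error \<xi> ` {1..n}"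
    by (simp add: image_image error_def signed_error_def dist_nearest_int_def)
  then show ?thesis by (simp add: irrationality_measure_fun_def psi_def)
qed

text \<open>Makes the ranking a function of the permutation alone, so rankings are no more numerous
  than permutations. The pairs are reversed because \<open>is_ordering_perm\<close> lists values in
  decreasing order.\<close>

lemma ranking_eq_ordering_perm:
  assumes "is_ordering_perm n \<alpha> (real m) \<sigma>"
  shows "ranking \<alpha> {1..n} m = {(\<sigma> j, \<sigma> i) | i j. i \<in> {1..n} \<and> j \<in> {1..n} \<and> i < j}"
proof -
  have \<sigma>: "\<sigma> permutes {1..n}"
    and dec: "\<And>i j. i \<in> {1..n} \<Longrightarrow> j \<in> {1..n} \<Longrightarrow> i < j \<Longrightarrow> psi (\<alpha> (\<sigma> j)) m < psi (\<alpha> (\<sigma> i)) m"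
    using assms by (auto simp: is_ordering_perm_def irrationality_measure_fun_eq_psi)
  show ?thesis
  proof (intro equalityI subsetI)
    fix x assume "x \<in> ranking \<alpha> {1..n} m"
    then obtain a b where x: "x = (a, b)" "a \<in> {1..n}" "b \<in> {1..n}" "psi (\<alpha> a) m < psi (\<alpha> b) m"
      by (auto simp: ranking_def)
    then obtain i j where ij: "i \<in> {1..n}" "j \<in> {1..n}" "a = \<sigma> j" "b = \<sigma> i"
      using permutes_image[OF \<sigma>] by (metis imageE)
    have "i < j" using dec[of j i] ij x(4) by (cases i j rule: linorder_cases) auto
    then show "x \<in> {(\<sigma> j, \<sigma> i) | i j. i \<in> {1..n} \<and> j \<in> {1..n} \<and> i < j}" using ij x by blast
  next
    fix x assume "x \<in> {(\<sigma> j, \<sigma> i) | i j. i \<in> {1..n} \<and> j \<in> {1..n} \<and> i < j}"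
    then show "x \<in> ranking \<alpha> {1..n} m"
      using dec permutes_in_image[OF \<sigma>] unfolding ranking_def by blast
  qed
qed

text \<open>Each of the finitely many permutations that do not recur infinitely often disappears
  after some time, so from some \<open>T\<close> on every ranking comes from a recurring
  one.\<close>

lemma eventually_card_rankings_le_k_index:
  assumes "pairwise (\<lambda>i j. independent_irrationals (\<alpha> i) (\<alpha> j)) {1..n}"
  shows "\<forall>\<^sub>F T in sequentially. card (ranking \<alpha> {1..n} ` {T..}) \<le> k_index n \<alpha>"
proof -
  define IO where "IO = {\<sigma>. \<forall>t\<^sub>0>0. \<exists>t>t\<^sub>0. ordering_perm n \<alpha> t = \<sigma>}"
  define P where "P = {\<sigma>. \<sigma> permutes {1..n}}"
  have "finite P" unfolding P_def by (rule finite_permutations) simp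
  have perm: "\<forall>\<^sub>F t in at_top. is_ordering_perm n \<alpha> t (ordering_perm n \<alpha> t)"
    using eventually_ex1_ordering_perm[OF assms]
  proof eventually_elim
    case (elim t)
    then show ?case unfolding ordering_perm_def by (rule theI')
  qed
  then obtain t1 where t1: "\<And>t. t1 \<le> t \<Longrightarrow> ordering_perm n \<alpha> t \<in> P"
    by (auto simp: eventually_at_top_linorder is_ordering_perm_def P_def)
  \<comment> \<open>Early values of \<open>ordering_perm\<close> may be unspecified, but members of
    \<open>IO\<close> recur at late times, where they are permutations. This makes \<open>IO\<close>
    finite; an infinite set would have \<open>card\<close> 0.\<close>
  have "IO \<subseteq> P"
  proof
    fix \<sigma> assume "\<sigma> \<in> IO"
    moreover have "0 < max 1 t1" by simp
    ultimately obtain t where "max 1 t1 < t" "ordering_perm n \<alpha> t = \<sigma>" unfolding IO_def by blast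
    then show "\<sigma> \<in> P" using t1[of t] by auto
  qed
  have "\<forall>\<^sub>F t in at_top. \<forall>\<sigma>\<in>P - IO. ordering_perm n \<alpha> t \<noteq> \<sigma>"
  proof (intro eventually_ball_finite ballI)
    fix \<sigma> assume "\<sigma> \<in> P - IO"
    then obtain t0 where "\<And>t. t0 < t \<Longrightarrow> ordering_perm n \<alpha> t \<noteq> \<sigma>" by (auto simp: IO_def)
    then show "\<forall>\<^sub>F t in at_top. ordering_perm n \<alpha> t \<noteq> \<sigma>"
      unfolding eventually_at_top_dense by blast
  qed (use \<open>finite P\<close> in simp)
  with perm have "\<forall>\<^sub>F t in at_top. is_ordering_perm n \<alpha> t (ordering_perm n \<alpha> t) \<and> ordering_perm n \<alpha> t \<in> IO"
    by eventually_elim (auto simp: is_ordering_perm_def P_def)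
  then have "\<forall>\<^sub>F m in sequentially. is_ordering_perm n \<alpha> (real m) (ordering_perm n \<alpha> (real m))
      \<and> ordering_perm n \<alpha> (real m) \<in> IO"
    by (rule eventually_compose_filterlim[OF _ filterlim_real_sequentially])
  then have "\<forall>\<^sub>F T in sequentially. \<forall>m\<ge>T. is_ordering_perm n \<alpha> (real m) (ordering_perm n \<alpha> (real m))
      \<and> ordering_perm n \<alpha> (real m) \<in> IO"
    by (rule eventually_all_ge_at_top)
  then show ?thesis
  proof eventually_elim
    case (elim T)
    define h where "h \<sigma> = {(\<sigma> j, \<sigma> i) | i j. i \<in> {1..n} \<and> j \<in> {1..n} \<and> i < j}" for \<sigma> :: "nat \<Rightarrow> nat"
    have "ranking \<alpha> {1..n} m \<in> h ` IO" if "T \<le> m" for m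
      using ranking_eq_ordering_perm[of n \<alpha> m] elim that unfolding h_def by blast
    then have "ranking \<alpha> {1..n} ` {T..} \<subseteq> h ` IO" by auto
    then have "card (ranking \<alpha> {1..n} ` {T..}) \<le> card (h ` IO)"
      using finite_subset[OF \<open>IO \<subseteq> P\<close> \<open>finite P\<close>] by (intro card_mono) auto
    also have "\<dots> \<le> card IO"
      using finite_subset[OF \<open>IO \<subseteq> P\<close> \<open>finite P\<close>] by (rule card_image_le)
    finally show ?case by (simp add: k_index_def IO_def)
  qed
qed

theorem theorem1:
  fixes n k :: nat and \<alpha> :: "nat \<Rightarrow> real"
  assumes "n \<ge> 1"
    and "\<And>i. i \<in> {1..n} \<Longrightarrow> \<alpha> i \<notin> \<rat>"
    and "pairwise (\<lambda>i j. independent_irrationals (\<alpha> i) (\<alpha> j)) {1..n}"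
    and "k_index n \<alpha> = k"
  shows "real n \<le> real k * (real k + 1) / 2"
proof -
  have ev: "\<forall>\<^sub>F T in sequentially. (\<forall>m\<ge>T. psi (\<alpha> i) m \<noteq> psi (\<alpha> j) m) \<and>
      (\<forall>s t. T \<le> t \<longrightarrow> \<not> (consec (\<alpha> i) s t \<and> consec (\<alpha> j) s t))"
    if "i \<in> {1..n}" "j \<in> {1..n}" "i \<noteq> j" for i j
  proof -
    have "independent_irrationals (\<alpha> i) (\<alpha> j)" using assms(3) that by (rule pairwiseD)
    then have "\<forall>\<^sub>F t in at_top. irrationality_measure_fun (\<alpha> i) t \<noteq> irrationality_measure_fun (\<alpha> j) t"
      by (simp add: independent_irrationals_def)
    then have "\<forall>\<^sub>F m in sequentially. psi (\<alpha> i) m \<noteq> psi (\<alpha> j) m"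
      unfolding irrationality_measure_fun_eq_psi[symmetric]
      by (rule eventually_compose_filterlim[OF _ filterlim_real_sequentially])
    then obtain N where N: "\<And>m. N \<le> m \<Longrightarrow> psi (\<alpha> i) m \<noteq> psi (\<alpha> j) m"
      by (auto simp: eventually_sequentially)
    have "\<alpha> i \<notin> \<rat>" "\<alpha> j \<notin> \<rat>" using assms(2) that by auto
    then obtain M where M: "\<And>s t. M \<le> t \<Longrightarrow> \<not> (consec (\<alpha> i) s t \<and> consec (\<alpha> j) s t)"
      using eventually_no_common_consec[OF _ _ N] by blast
    show ?thesis
      unfolding eventually_sequentially using N M by (intro exI[of _ "max M N"]) auto
  qed
  \<comment> \<open>There are finitely many pairs, so one threshold serves all of them; the
    induction keeps it fixed.\<close>
  have "\<forall>\<^sub>F T in sequentially. \<forall>i\<in>{1..n}. \<forall>j\<in>{1..n}. i \<noteq> j \<longrightarrow>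
      (\<forall>m\<ge>T. psi (\<alpha> i) m \<noteq> psi (\<alpha> j) m) \<and>
      (\<forall>s t. T \<le> t \<longrightarrow> \<not> (consec (\<alpha> i) s t \<and> consec (\<alpha> j) s t))"
    using ev by (intro eventually_ball_finite ballI) (auto simp: eventually_conj_iff)
  with eventually_card_rankings_le_k_index[OF assms(3)] eventually_ge_at_top[of 1]
  have "\<forall>\<^sub>F T in sequentially. 2 * card {1..n} \<le> k * (k + 1)"
  proof eventually_elim
    case (elim T)
    have "2 * card {1..n} \<le> card (ranking \<alpha> {1..n} ` {T..}) * (card (ranking \<alpha> {1..n} ` {T..}) + 1)"
      by (rule card_le_triangle_rankings) (use elim assms(2) in blast)+
    also have "\<dots> \<le> k * (k + 1)"
      using elim(1) assms(4) by (intro mult_le_mono) auto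
    finally show ?case .
  qed
  \<comment> \<open>The inequality does not mention \<open>T\<close>, so holding eventually it holds
    outright.\<close>
  then have "2 * n \<le> k * (k + 1)" by simp
  then have "real (2 * n) \<le> real (k * (k + 1))" by (simp only: of_nat_le_iff)
  then show ?thesis by (simp add: algebra_simps)
qed

end
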